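(* The following seven propositions are equivalent: (1) There exists a continuum without coastal points. (2) There exists a continuum with exactly one non-coastal point. (3) There exists a partially coastal continuum. (4) There exists a continuum without shore points. (5) There exists a continuum with exactly one shore point. (6) There exists a continuum without non-block points. (7) There exists a continuum with exactly one non-block point.
   Context: A continuum is a nondegenerate (more than one point) compact connected Hausdorff space, not necessarily metrizable. A subcontinuum of a space is a nonempty compact connected subset (singletons allowed). A subset $A$ of a continuum $X$ is a semicontinuum if for all $a,c\in A$ there is a subcontinuum $K\subset A$ of $X$ with $\{a,c\}\subset K$. The continuum components of a subset $A\subset X$ are the maximal semicontinua contained in $A$; they partition $A$. Let $X$ be a continuum. - A point $p\in X$ is a shore point if for every finite collection of nonempty open sets $U_1,\dots,U_n\subset X$ some subcontinuum $K\subset X\setminus\{p\}$ meets each $U_m$. - A point $p\in X$ is a non-block point if $X\setminus\{p\}$ has a continuum component that is dense in $X$. - A point $x\in X$ is coastal if $x$ is an element of some proper dense semicontinuum of $X$ (a semicontinuum $S\subsetneq X$ dense in $X$); otherwise $x$ is non-coastal. - $X$ is partially coastal if there are points $x,y\in X$ with $x$ coastal and $y$ non-coastal. *)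

theory Defs
  imports "HOL-Analysis.Analysis"
begin

definition continuum :: "'a topology \<Rightarrow> bool" where
  "continuum X \<longleftrightarrow> compact_space X \<and> connected_space X \<and> Hausdorff_space X \<and>
     (\<exists>x\<in>topspace X. \<exists>y\<in>topspace X. x \<noteq> y)"

(* connectedin holds of the empty set, so nonemptiness is demanded separately. *)
definition subcontinuum :: "'a topology \<Rightarrow> 'a set \<Rightarrow> bool" where
  "subcontinuum X K \<longleftrightarrow> K \<noteq> {} \<and> compactin X K \<and> connectedin X K"

definition semicontinuum :: "'a topology \<Rightarrow> 'a set \<Rightarrow> bool" where
  "semicontinuum X A \<longleftrightarrow> A \<subseteq> topspace X \<and>
     (\<forall>a\<in>A. \<forall>c\<in>A. \<exists>K. subcontinuum X K \<and> K \<subseteq> A \<and> {a, c} \<subseteq> K)"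

definition continuum_component :: "'a topology \<Rightarrow> 'a set \<Rightarrow> 'a set \<Rightarrow> bool" where
  "continuum_component X A C \<longleftrightarrow> semicontinuum X C \<and> C \<subseteq> A \<and>
     (\<forall>D. semicontinuum X D \<and> D \<subseteq> A \<and> C \<subseteq> D \<longrightarrow> D = C)"

definition shore_point :: "'a topology \<Rightarrow> 'a \<Rightarrow> bool" where
  "shore_point X p \<longleftrightarrow> p \<in> topspace X \<and>
     (\<forall>\<U>. finite \<U> \<and> (\<forall>U\<in>\<U>. openin X U \<and> U \<noteq> {}) \<longrightarrow>
       (\<exists>K. subcontinuum X K \<and> K \<subseteq> topspace X - {p} \<and> (\<forall>U\<in>\<U>. K \<inter> U \<noteq> {})))"

definition non_block_point :: "'a topology \<Rightarrow> 'a \<Rightarrow> bool" where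
  "non_block_point X p \<longleftrightarrow> p \<in> topspace X \<and>
     (\<exists>C. continuum_component X (topspace X - {p}) C \<and> X closure_of C = topspace X)"

definition coastal_point :: "'a topology \<Rightarrow> 'a \<Rightarrow> bool" where
  "coastal_point X x \<longleftrightarrow>
     (\<exists>S. semicontinuum X S \<and> S \<subset> topspace X \<and> X closure_of S = topspace X \<and> x \<in> S)"

definition non_coastal_point :: "'a topology \<Rightarrow> 'a \<Rightarrow> bool" where
  "non_coastal_point X x \<longleftrightarrow> x \<in> topspace X \<and> \<not> coastal_point X x"

definition partially_coastal :: "'a topology \<Rightarrow> bool" where
  "partially_coastal X \<longleftrightarrow> (\<exists>x y. coastal_point X x \<and> non_coastal_point X y)"

end

theory Submission
  imports Defs
begin

text \<open>
  A point $x$ is coastal iff some dense semicontinuum through $x$ misses a point, and such a missed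
  point is a non-block point; non-block points are shore points. Hence each of the seven
  propositions yields a continuum $X$ with a non-coastal point $y$. Conversely, glue
  a continuum $Z$ to $X$ by identifying $y$ with a point of $Z$. A subcontinuum
  that reaches into both summands passes through the gluing point. Hence, if a point $q$ of $X$ were
  a shore point of the wedge, then the traces on $X$ of the subcontinua through the gluing point
  that avoid $q$ would unite to a proper dense semicontinuum containing $y$. So the wedge
  of two copies of $X$ has no shore point at all, while in the wedge of $X$ and an arc the far end
  of the arc is the only shore point, the only non-block point and the only non-coastal point.
\<close>

section \<open>Semicontinua\<close>

lemma subcontinuum_image:
  assumes "continuous_map X Y f" "subcontinuum X K"
  shows "subcontinuum Y (f ` K)"
  using assms unfolding subcontinuum_def
  by (auto intro: image_compactin connectedin_continuous_map_image)

lemma subcontinuum_Un: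
  assumes "subcontinuum X K" "subcontinuum X L" "K \<inter> L \<noteq> {}"
  shows "subcontinuum X (K \<union> L)"
  using assms unfolding subcontinuum_def
  by (auto intro: compactin_Un connectedin_Un)

lemma subcontinuum_subset_topspace:
  "subcontinuum X K \<Longrightarrow> K \<subseteq> topspace X"
  by (auto simp: subcontinuum_def compactin_subset_topspace)

lemma subcontinuum_topspace:
  "continuum X \<Longrightarrow> subcontinuum X (topspace X)"
  by (auto simp: subcontinuum_def continuum_def compact_space_def connectedin_topspace)

lemma continuum_t1_space: "continuum X \<Longrightarrow> t1_space X"
  by (simp add: continuum_def Hausdorff_imp_t1_space)

lemma openin_delete_point:
  "continuum X \<Longrightarrow> openin X (topspace X - {p})"
  by (meson continuum_t1_space openin_topspace t1_space_openin_delete_alt)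

lemma continuum_delete_point_nonempty:
  "continuum X \<Longrightarrow> topspace X - {p} \<noteq> {}"
  by (auto simp: continuum_def)

lemma continuum_not_singleton:
  "continuum X \<Longrightarrow> \<nexists>a. topspace X \<subseteq> {a}"
  using continuum_delete_point_nonempty[of X] by (simp only: Diff_eq_empty_iff) simp

text \<open>Two subcontinua through the base point \<open>w\<close> overlap there, so their union is
  again a subcontinuum; reaching every point of \<open>A\<close> from \<open>w\<close> is therefore
  enough.\<close>

lemma semicontinuum_star:
  assumes "\<And>c. c \<in> A \<Longrightarrow> \<exists>K. subcontinuum X K \<and> K \<subseteq> A \<and> w \<in> K \<and> c \<in> K"
  shows "semicontinuum X A"
  unfolding semicontinuum_def
proof (intro conjI ballI)
  show "A \<subseteq> topspace X"
    using assms subcontinuum_subset_topspace by blast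
next
  fix a c assume "a \<in> A" "c \<in> A"
  then obtain K L where "subcontinuum X K" "K \<subseteq> A" "w \<in> K" "a \<in> K"
    and "subcontinuum X L" "L \<subseteq> A" "w \<in> L" "c \<in> L"
    using assms by meson
  then show "\<exists>K. subcontinuum X K \<and> K \<subseteq> A \<and> {a, c} \<subseteq> K"
    by (intro exI[of _ "K \<union> L"]) (auto intro: subcontinuum_Un)
qed

text \<open>The component is the union \<open>C\<close> of all subcontinua of \<open>A\<close>
  through one point \<open>s\<close> of \<open>S\<close>. It swallows every semicontinuum in
  \<open>A\<close> that contains \<open>s\<close>, so maximality comes without Zorn's lemma.\<close>

lemma semicontinuum_extend_component:
  assumes "semicontinuum X S" "S \<noteq> {}" "S \<subseteq> A"
  obtains C where "continuum_component X A C" "S \<subseteq> C"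
proof -
  obtain s where s: "s \<in> S"
    using assms by blast
  define C where "C = \<Union>{K. subcontinuum X K \<and> K \<subseteq> A \<and> s \<in> K}"
  have semi: "semicontinuum X C"
    by (rule semicontinuum_star[where w = s]) (auto simp: C_def)
  have in_C: "D \<subseteq> C" if "semicontinuum X D" "D \<subseteq> A" "s \<in> D" for D
  proof
    fix d assume "d \<in> D"
    then obtain K where "subcontinuum X K" "K \<subseteq> D" "{s, d} \<subseteq> K"
      using \<open>semicontinuum X D\<close> \<open>s \<in> D\<close> unfolding semicontinuum_def by meson
    then show "d \<in> C"
      using \<open>D \<subseteq> A\<close> by (auto simp: C_def)
  qed
  have SC: "S \<subseteq> C"
    using in_C assms s by blast
  have "C \<subseteq> A"
    by (auto simp: C_def)
  moreover have "D = C" if "semicontinuum X D" "D \<subseteq> A" "C \<subseteq> D" for D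
  proof (rule subset_antisym)
    show "D \<subseteq> C"
      using in_C that SC s by (meson subsetD)
  qed fact
  ultimately have "continuum_component X A C"
    using semi by (simp add: continuum_component_def)
  then show thesis
    using SC by (rule that)
qed

section \<open>Coastal, non-block and shore points\<close>

text \<open>A dense semicontinuum missing \<open>p\<close> lies in a continuum component of the
  punctured space, which is then dense too. Later arguments can thus ignore maximality.\<close>

lemma non_block_point_iff:
  assumes "continuum X"
  shows "non_block_point X p \<longleftrightarrow> p \<in> topspace X \<and>
    (\<exists>S. semicontinuum X S \<and> S \<subseteq> topspace X - {p} \<and> X closure_of S = topspace X)"
proof
  assume "non_block_point X p"
  then show "p \<in> topspace X \<and>
    (\<exists>S. semicontinuum X S \<and> S \<subseteq> topspace X - {p} \<and> X closure_of S = topspace X)"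
    unfolding non_block_point_def continuum_component_def by blast
next
  assume "p \<in> topspace X \<and>
    (\<exists>S. semicontinuum X S \<and> S \<subseteq> topspace X - {p} \<and> X closure_of S = topspace X)"
  then obtain S where p: "p \<in> topspace X"
    and S: "semicontinuum X S" "S \<subseteq> topspace X - {p}" "X closure_of S = topspace X"
    by blast
  then have "S \<noteq> {}"
    by auto
  then obtain C where C: "continuum_component X (topspace X - {p}) C" and "S \<subseteq> C"
    using semicontinuum_extend_component[OF S(1) _ S(2)] by metis
  then have "X closure_of C = topspace X"
    using S(3) closure_of_mono closure_of_subset_topspace by (metis subset_antisym)
  with p C show "non_block_point X p"
    unfolding non_block_point_def by (intro conjI exI[of _ C])
qed

lemma coastal_point_in_topspace: "coastal_point X x \<Longrightarrow> x \<in> topspace X"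
  by (auto simp: coastal_point_def)

lemma coastal_pointI:
  assumes "semicontinuum X S" "S \<subseteq> topspace X - {p}" "p \<in> topspace X"
    "X closure_of S = topspace X" "x \<in> S"
  shows "coastal_point X x"
  unfolding coastal_point_def
proof (intro exI[of _ S] conjI)
  show "S \<subset> topspace X"
    using assms(2,3) by blast
qed (fact assms)+

text \<open>The proper semicontinuum that makes \<open>x\<close> coastal misses some
  \<open>p\<close>, and the same set shows that \<open>p\<close> is non-block.\<close>

lemma coastal_point_avoids_non_block_point:
  assumes "continuum X" "coastal_point X x"
  obtains p where "non_block_point X p" "p \<noteq> x"
proof -
  obtain S where S: "semicontinuum X S" "S \<subset> topspace X" "X closure_of S = topspace X" "x \<in> S"
    using assms(2) unfolding coastal_point_def by blast
  then obtain p where p: "p \<in> topspace X" "p \<notin> S"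
    by blast
  moreover from this have "S \<subseteq> topspace X - {p}"
    using S(2) by blast
  ultimately have "non_block_point X p"
    using S(1,3) non_block_point_iff[OF assms(1)] by metis
  then show thesis
    using that \<open>p \<notin> S\<close> S(4) by blast
qed

lemma non_block_point_imp_coastal_point:
  assumes "continuum X" "non_block_point X p"
  obtains x where "coastal_point X x"
proof -
  obtain S where S: "semicontinuum X S" "S \<subseteq> topspace X - {p}" "X closure_of S = topspace X"
    and p: "p \<in> topspace X"
    using assms(2) non_block_point_iff[OF assms(1)] by metis
  then have "S \<noteq> {}"
    by auto
  then obtain x where "x \<in> S"
    by blast
  then show thesis
    by (rule that[OF coastal_pointI[OF S(1,2) p S(3)]])
qed

lemma no_coastal_point_iff_no_non_block_point:
  assumes "continuum X"
  shows "(\<nexists>x. coastal_point X x) \<longleftrightarrow> (\<nexists>p. non_block_point X p)"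
  by (auto elim: coastal_point_avoids_non_block_point[OF assms]
      non_block_point_imp_coastal_point[OF assms])

text \<open>Induction on \<open>F\<close>: the continuum for the old points and one joining
  \<open>s\<close> to the new point share \<open>s\<close>.\<close>

lemma semicontinuum_finite_subset:
  assumes "semicontinuum X S" "finite F" "F \<subseteq> S" "s \<in> S"
  shows "\<exists>K. subcontinuum X K \<and> K \<subseteq> S \<and> insert s F \<subseteq> K"
  using assms(2,3)
proof (induction F rule: finite_induct)
  case empty
  then show ?case
    using assms(1,4) unfolding semicontinuum_def by (metis insert_absorb2)
next
  case (insert a F)
  then obtain K where K: "subcontinuum X K" "K \<subseteq> S" "insert s F \<subseteq> K"
    by blast
  obtain L where L: "subcontinuum X L" "L \<subseteq> S" "{s, a} \<subseteq> L"
    using assms(1,4) insert.prems unfolding semicontinuum_def by (meson insert_subset)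
  have "subcontinuum X (K \<union> L)"
    using K L by (intro subcontinuum_Un) auto
  then show ?case
    using K L by (intro exI[of _ "K \<union> L"]) auto
qed

text \<open>Density puts a point of \<open>S\<close> into each of the finitely many open sets, and a
  single subcontinuum of \<open>S\<close> contains all these points.\<close>

lemma non_block_point_imp_shore_point:
  assumes "continuum X" "non_block_point X p"
  shows "shore_point X p"
proof -
  obtain S where S: "semicontinuum X S" "S \<subseteq> topspace X - {p}" "X closure_of S = topspace X"
    and p: "p \<in> topspace X"
    using assms(2) non_block_point_iff[OF assms(1)] by metis
  then have "S \<noteq> {}"
    by auto
  then obtain s where "s \<in> S"
    by blast
  show ?thesis
    unfolding shore_point_def
  proof (intro conjI p allI impI)
    fix \<U> assume U: "finite \<U> \<and> (\<forall>U\<in>\<U>. openin X U \<and> U \<noteq> {})"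
    then have "\<forall>U\<in>\<U>. S \<inter> U \<noteq> {}"
      using S(3) by (simp add: dense_intersects_open)
    then have "\<forall>U\<in>\<U>. \<exists>a. a \<in> S \<inter> U"
      by (metis equals0I)
    then obtain a where a: "\<forall>U\<in>\<U>. a U \<in> S \<inter> U"
      by (rule bchoice[THEN exE])
    then have "finite (a ` \<U>)" "a ` \<U> \<subseteq> S"
      using U by auto
    then obtain K where K: "subcontinuum X K" "K \<subseteq> S" "insert s (a ` \<U>) \<subseteq> K"
      using semicontinuum_finite_subset[OF S(1) _ _ \<open>s \<in> S\<close>] by metis
    show "\<exists>K. subcontinuum X K \<and> K \<subseteq> topspace X - {p} \<and> (\<forall>U\<in>\<U>. K \<inter> U \<noteq> {})"
    proof (intro exI[of _ K] conjI ballI)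
      show "K \<subseteq> topspace X - {p}"
        using K(2) S(2) by (rule subset_trans)
      fix U assume "U \<in> \<U>"
      then have "a U \<in> K \<inter> U"
        using a K(3) by auto
      then show "K \<inter> U \<noteq> {}"
        by auto
    qed (fact K)
  qed
qed

text \<open>The wedge arguments apply the shore property only to pairs of open sets, one in each
  summand.\<close>

lemma shore_point_meets_two:
  assumes "shore_point X p" "openin X U" "U \<noteq> {}" "openin X V" "V \<noteq> {}"
  obtains K u v where "subcontinuum X K" "K \<subseteq> topspace X - {p}"
    "u \<in> K" "u \<in> U" "v \<in> K" "v \<in> V"
proof -
  have "finite {U, V} \<and> (\<forall>W\<in>{U, V}. openin X W \<and> W \<noteq> {})"
    using assms by simp
  then have "\<exists>K. subcontinuum X K \<and> K \<subseteq> topspace X - {p} \<and> (\<forall>W\<in>{U, V}. K \<inter> W \<noteq> {})"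
    using assms(1) unfolding shore_point_def by metis
  then obtain K where K: "subcontinuum X K" "K \<subseteq> topspace X - {p}" "\<forall>W\<in>{U, V}. K \<inter> W \<noteq> {}"
    by (elim exE conjE)
  then obtain u v where "u \<in> K" "u \<in> U" "v \<in> K" "v \<in> V"
    by auto
  then show thesis
    by (rule that[OF K(1,2)])
qed

text \<open>If every point were coastal, any point would yield a non-block point \<open>p\<close>,
  and coastality of \<open>p\<close> itself would yield a second one.\<close>

lemma at_most_one_non_block_point_imp_non_coastal_point:
  assumes "continuum X" "\<And>p q. non_block_point X p \<Longrightarrow> non_block_point X q \<Longrightarrow> p = q"
  obtains y where "non_coastal_point X y"
proof (rule ccontr)
  assume "\<not> thesis"
  then have "\<not> non_coastal_point X x" for x
    using that by blast
  then have all: "x \<in> topspace X \<Longrightarrow> coastal_point X x" for x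
    by (auto simp: non_coastal_point_def)
  obtain x where "x \<in> topspace X"
    using assms(1) unfolding continuum_def by blast
  then obtain p where p: "non_block_point X p"
    using all coastal_point_avoids_non_block_point[OF assms(1)] by metis
  then have "p \<in> topspace X"
    by (simp add: non_block_point_def)
  then obtain q where "non_block_point X q" "q \<noteq> p"
    using all coastal_point_avoids_non_block_point[OF assms(1)] by metis
  then show False
    using assms(2) p by blast
qed

section \<open>Wedges\<close>

text \<open>
  \<open>Y\<close> is the wedge of \<open>X\<close> and \<open>Z\<close> with \<open>y\<close> and \<open>z\<close> identified: \<open>f\<close> and \<open>g\<close> embed the two
  summands, and \<open>r\<close> and \<open>s\<close> are the retractions that collapse the respective other summand.
\<close>

locale wedge =
  fixes X :: "'a topology" and y :: 'a and Z :: "'b topology" and z :: 'b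
    and Y :: "'c topology" and f :: "'a \<Rightarrow> 'c" and r :: "'c \<Rightarrow> 'a" and g :: "'b \<Rightarrow> 'c" and s :: "'c \<Rightarrow> 'b"
  assumes X: "continuum X" and y: "y \<in> topspace X"
    and Z: "continuum Z" and z: "z \<in> topspace Z"
    and f: "continuous_map X Y f" and r: "continuous_map Y X r"
    and g: "continuous_map Z Y g" and s: "continuous_map Y Z s"
    and rf: "\<And>a. a \<in> topspace X \<Longrightarrow> r (f a) = a"
    and sg: "\<And>b. b \<in> topspace Z \<Longrightarrow> s (g b) = b"
    and rg: "\<And>b. b \<in> topspace Z \<Longrightarrow> r (g b) = y"
    and sf: "\<And>a. a \<in> topspace X \<Longrightarrow> s (f a) = z"
    and fy_gz: "f y = g z"
    and cover: "topspace Y = f ` topspace X \<union> g ` topspace Z"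
begin

text \<open>By this symmetry each result about the \<open>X\<close> side also serves the
  \<open>Z\<close> side.\<close>

lemma swap: "wedge Z z X y Y g s f r"
  by unfold_locales (use X y Z z f r g s rf sg rg sf fy_gz cover in auto)

lemma continuum_wedge: "continuum Y"
  unfolding continuum_def
proof (intro conjI)
  have "subcontinuum Y (f ` topspace X \<union> g ` topspace Z)"
  proof (rule subcontinuum_Un)
    show "f ` topspace X \<inter> g ` topspace Z \<noteq> {}"
      using fy_gz y z by blast
  qed (intro subcontinuum_image[OF f] subcontinuum_image[OF g] subcontinuum_topspace X Z)+
  then have "subcontinuum Y (topspace Y)"
    by (simp add: cover)
  then show "compact_space Y" "connected_space Y"
    by (simp_all add: subcontinuum_def compact_space_def connectedin_topspace)
  \<comment> \<open>A point is recovered from its two coordinates: it lies in the \<open>X\<close>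
    summand exactly when \<open>s v = z\<close>. Hence the pair of retractions injects
    \<open>Y\<close> into a Hausdorff product.\<close>
  have "v = (if s v = z then f (r v) else g (s v))" if "v \<in> topspace Y" for v
    using that unfolding cover by (auto simp: rf sg rg sf fy_gz)
  then have "inj_on (\<lambda>v. (r v, s v)) (topspace Y)"
    by (intro inj_onI) (metis Pair_inject)
  moreover have "Hausdorff_space (prod_topology X Z)"
    using X Z by (simp add: continuum_def Hausdorff_space_prod_topology)
  ultimately show "Hausdorff_space Y"
    using Hausdorff_space_injective_preimage continuous_map_pairedI[OF r s] by metis
  obtain a a' where "a \<in> topspace X" "a' \<in> topspace X" "a \<noteq> a'"
    using X unfolding continuum_def by blast
  moreover from this have "f a \<noteq> f a'"
    using rf by metis
  ultimately show "\<exists>u\<in>topspace Y. \<exists>v\<in>topspace Y. u \<noteq> v"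
    unfolding cover by blast
qed

section \<open>Shore points of a wedge\<close>

lemma
  shows openin_left: "openin X U \<Longrightarrow> openin Y {v \<in> topspace Y. r v \<in> U}"
    and openin_right: "openin Z V \<Longrightarrow> openin Y {v \<in> topspace Y. s v \<in> V}"
  by (simp_all add: openin_continuous_map_preimage[OF r] openin_continuous_map_preimage[OF s])

text \<open>Without the gluing point, \<open>K\<close> would be covered by the two punctured
  summands, which are open and disjoint and both meet \<open>K\<close>.\<close>

lemma through_gluing_point:
  assumes K: "subcontinuum Y K" and "u \<in> K" "r u \<noteq> y" and "v \<in> K" "s v \<noteq> z"
  shows "f y \<in> K"
proof (rule ccontr)
  assume nin: "f y \<notin> K"
  \<comment> \<open>Since \<open>r\<close> sends all of \<open>Z\<close> to \<open>y\<close>, this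
    preimage is the \<open>X\<close> summand without the gluing point; \<open>?E2\<close> is its
    counterpart in \<open>Z\<close>.\<close>
  let ?E1 = "{v \<in> topspace Y. r v \<in> topspace X - {y}}"
  let ?E2 = "{v \<in> topspace Y. s v \<in> topspace Z - {z}}"
  have KY: "K \<subseteq> topspace Y"
    using K by (rule subcontinuum_subset_topspace)
  have "openin Y ?E1" "openin Y ?E2"
    by (intro openin_left openin_right openin_delete_point X Z)+
  moreover have "K \<subseteq> ?E1 \<union> ?E2"
  proof
    fix k assume "k \<in> K"
    then have "k \<in> topspace Y" "k \<noteq> f y"
      using KY nin by auto
    then show "k \<in> ?E1 \<union> ?E2"
      unfolding cover using fy_gz by (auto simp: rf sg)
  qed
  moreover have "?E1 \<inter> ?E2 \<inter> K = {}"
    unfolding cover by (auto simp: rg sf)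
  moreover have "u \<in> ?E1 \<inter> K" "v \<in> ?E2 \<inter> K"
    using assms(2-) KY r s by (auto simp: continuous_map_def Pi_iff)
  then have "?E1 \<inter> K \<noteq> {}" "?E2 \<inter> K \<noteq> {}"
    by blast+
  moreover have "connectedin Y K"
    using K by (simp add: subcontinuum_def)
  ultimately show False
    using connectedinD[of Y K ?E1 ?E2] by argo
qed

lemma nonempty_left:
  assumes "openin X U" "U \<noteq> {}"
  shows "{v \<in> topspace Y. r v \<in> U} \<noteq> {}"
proof -
  obtain a where "a \<in> U" "a \<in> topspace X"
    using assms openin_subset by blast
  then have "f a \<in> {v \<in> topspace Y. r v \<in> U}"
    by (simp add: rf cover)
  then show ?thesis
    by blast
qed

text \<open>The shore property is applied to the preimage of \<open>U\<close> and to the punctured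
  \<open>Z\<close> summand. As \<open>y \<notin> U\<close>, a continuum meeting both has to pass
  through the gluing point.\<close>

lemma shore_point_continuum:
  assumes "shore_point Y q" and U: "openin X U" "U \<noteq> {}" "y \<notin> U"
  obtains K where "subcontinuum Y K" "K \<subseteq> topspace Y - {q}" "f y \<in> K" "r ` K \<inter> U \<noteq> {}"
proof -
  interpret sw: wedge Z z X y Y g s f r
    by (rule swap)
  let ?U = "{v \<in> topspace Y. r v \<in> U}" and ?V = "{v \<in> topspace Y. s v \<in> topspace Z - {z}}"
  have U': "openin Y ?U" "?U \<noteq> {}"
    by (rule openin_left[OF U(1)], rule nonempty_left[OF U(1,2)])
  have V': "openin Y ?V" "?V \<noteq> {}"
    by (rule openin_right[OF openin_delete_point[OF Z]],
        rule sw.nonempty_left[OF openin_delete_point[OF Z] continuum_delete_point_nonempty[OF Z]])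
  obtain K u v where K: "subcontinuum Y K" "K \<subseteq> topspace Y - {q}"
    and "u \<in> K" "u \<in> ?U" "v \<in> K" "v \<in> ?V"
    by (rule shore_point_meets_two[OF assms(1) U' V'])
  then have uv: "u \<in> K" "r u \<in> U" "v \<in> K" "s v \<noteq> z"
    by simp_all
  then have "f y \<in> K"
    using through_gluing_point K(1) U(3) by metis
  moreover have "r ` K \<inter> U \<noteq> {}"
    using uv by blast
  ultimately show thesis
    by (rule that[OF K])
qed

text \<open>Applying \<open>r\<close> computes the trace on \<open>X\<close> of a continuum through
  \<open>f y\<close>: its part in \<open>Z\<close> collapses to \<open>y\<close>, which already
  belongs to the trace. The union of these traces is the witness.\<close>

lemma shore_point_imp_semicontinuum:
  assumes q: "shore_point Y (f q)" "q \<in> topspace X"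
  obtains S where "semicontinuum X S" "S \<subseteq> topspace X - {q}" "X closure_of S = topspace X" "y \<in> S"
proof -
  define S where "S = \<Union>{r ` K | K. subcontinuum Y K \<and> K \<subseteq> topspace Y - {f q} \<and> f y \<in> K}"
  have ry: "r (f y) = y"
    by (simp add: rf y)
  have S_I: "r ` K \<subseteq> S" if "subcontinuum Y K" "K \<subseteq> topspace Y - {f q}" "f y \<in> K" for K
    using that by (auto simp: S_def)
  have meets: "S \<inter> U \<noteq> {}" if U: "openin X U" "U \<noteq> {}" "y \<notin> U" for U
  proof -
    obtain K where "subcontinuum Y K" "K \<subseteq> topspace Y - {f q}" "f y \<in> K" "r ` K \<inter> U \<noteq> {}"
      using shore_point_continuum[OF q(1) U] by metis
    then show ?thesis
      using S_I[of K] by blast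
  qed
  \<comment> \<open>This open set serves to produce one continuum \<open>K\<close> of the family.
    Its trace puts \<open>y\<close> into \<open>S\<close>, and since it contains \<open>f y\<close>
    but not \<open>f q\<close>, also \<open>q \<noteq> y\<close>.\<close>
  have "S \<inter> (topspace X - {y}) \<noteq> {}"
    by (intro meets openin_delete_point continuum_delete_point_nonempty X) simp
  then obtain a where "a \<in> S"
    by blast
  then obtain K where K: "subcontinuum Y K" "K \<subseteq> topspace Y - {f q}" "f y \<in> K"
    by (auto simp: S_def)
  then have yS: "y \<in> S"
    using S_I[OF K] ry by (metis imageI subsetD)
  have qy: "q \<noteq> y"
    using K by blast
  have S_sub: "S \<subseteq> topspace X - {q}"
  proof
    fix a assume "a \<in> S"
    then obtain k where k: "k \<in> topspace Y" "k \<noteq> f q" "a = r k"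
      by (auto simp: S_def)
    \<comment> \<open>A point from \<open>X\<close> is returned to its origin, which is not
      \<open>q\<close>; a point from \<open>Z\<close> goes to \<open>y\<close>, which differs from
      \<open>q\<close>.\<close>
    then have "r k \<noteq> q"
      using qy unfolding cover by (auto simp: rf rg)
    then show "a \<in> topspace X - {q}"
      using k r by (auto simp: continuous_map_def Pi_iff)
  qed
  moreover have "semicontinuum X S"
  proof (rule semicontinuum_star[where w = y])
    fix c assume "c \<in> S"
    then obtain K where K: "subcontinuum Y K" "K \<subseteq> topspace Y - {f q}" "f y \<in> K" "c \<in> r ` K"
      by (auto simp: S_def)
    then show "\<exists>K. subcontinuum X K \<and> K \<subseteq> S \<and> y \<in> K \<and> c \<in> K"
      using subcontinuum_image[OF r K(1)] S_I[OF K(1-3)] ry by (metis imageI)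
  qed
  moreover have "X closure_of S = topspace X"
    unfolding dense_intersects_open
  proof (intro allI impI)
    fix T assume T: "openin X T \<and> T \<noteq> {}"
    show "S \<inter> T \<noteq> {}"
    proof (cases "y \<in> T")
      case False
      then show ?thesis
        using meets T by simp
    qed (use yS in auto)
  qed
  ultimately show thesis
    using that yS by metis
qed

lemma non_coastal_imp_no_shore_point_left:
  assumes "non_coastal_point X y" "q \<in> topspace X"
  shows "\<not> shore_point Y (f q)"
  using assms shore_point_imp_semicontinuum coastal_pointI
  unfolding non_coastal_point_def by metis

lemma non_coastal_imp_no_shore_point:
  assumes "non_coastal_point X y" "non_coastal_point Z z"
  shows "\<not> shore_point Y p"
proof
  interpret sw: wedge Z z X y Y g s f r
    by (rule swap)
  assume p: "shore_point Y p"
  then have "p \<in> topspace Y"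
    by (simp add: shore_point_def)
  then show False
    using p non_coastal_imp_no_shore_point_left[OF assms(1)]
      sw.non_coastal_imp_no_shore_point_left[OF assms(2)] by (auto simp: cover)
qed

end

text \<open>\<open>Y\<close> must live on the type of \<open>X\<close>, because the theorem fixes
  one type. A continuum is infinite, so that type absorbs its own square, and \<open>le\<close>
  injects the points of \<open>Z\<close>; the wedge inside the product can then be copied into
  it.\<close>

lemma wedge_exists:
  fixes X :: "'a topology" and Z :: "'b topology"
  assumes "continuum X" "y \<in> topspace X" "continuum Z" "z \<in> topspace Z"
    and le: "(UNIV :: 'b set) \<lesssim> (UNIV :: 'a set)"
  shows "\<exists>(Y :: 'a topology) f r g s. wedge X y Z z Y f r g s"
proof -
  have "connected_space X" "Hausdorff_space X"
    using assms(1) by (simp_all add: continuum_def)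
  then have "infinite (topspace X)"
    by (rule connected_space_imp_infinite[OF _ _ continuum_not_singleton[OF assms(1)]])
  then have "infinite (UNIV :: 'a set)"
    by (rule infinite_super[OF subset_UNIV])
  then have "\<exists>h :: 'a \<times> 'a \<Rightarrow> 'a. bij_betw h (UNIV \<times> UNIV) UNIV"
    by (rule card_of_ordIso[THEN iffD2, OF card_of_Times_same_infinite])
  then obtain h :: "'a \<times> 'a \<Rightarrow> 'a" where h: "bij_betw h (UNIV \<times> UNIV) UNIV" ..
  have "\<exists>j :: 'b \<Rightarrow> 'a. inj j"
    using le[unfolded lepoll_def] by (rule ex_forward) (erule conjunct1)
  then obtain j :: "'b \<Rightarrow> 'a" where j: "inj j" ..
  define e where "e = h \<circ> map_prod id j"
  have "inj h"
    using h by (simp add: bij_betw_def)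
  then have "inj e"
    unfolding e_def by (rule inj_compose[OF _ prod.inj_map[OF inj_on_id j]])
  then have ie: "inv e (e p) = p" for p
    by simp
  \<comment> \<open>The two axes of the product through \<open>(y, z)\<close> form the
    wedge.\<close>
  define P where "P = topspace X \<times> {z} \<union> {y} \<times> topspace Z"
  \<comment> \<open>Pulling back along \<open>inv e\<close> transports the subspace topology of
    \<open>P\<close> to its copy under \<open>e\<close>.\<close>
  define Y where "Y = pullback_topology (e ` P) (inv e) (prod_topology X Z)"
  have top: "topspace Y = e ` P"
    using assms by (auto simp: Y_def topspace_pullback_topology P_def ie)
  have inv_e: "continuous_map Y (prod_topology X Z) (inv e)"
    using continuous_map_pullback[OF continuous_map_id, of "e ` P" "inv e" "prod_topology X Z"]
    by (simp add: Y_def)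
  have into: "continuous_map W Y (\<lambda>v. e (k v))"
    if "continuous_map W (prod_topology X Z) k" "k ` topspace W \<subseteq> P" for W :: "'w topology" and k
    unfolding Y_def
  proof (rule continuous_map_pullback')
    show "continuous_map W (prod_topology X Z) (inv e \<circ> (\<lambda>v. e (k v)))"
      using that(1) by (simp add: o_def ie)
  qed (use that(2) in auto)
  have "wedge X y Z z Y (\<lambda>a. e (a, z)) (\<lambda>v. fst (inv e v)) (\<lambda>b. e (y, b)) (\<lambda>v. snd (inv e v))"
  proof
    show "continuous_map X Y (\<lambda>a. e (a, z))"
      using assms by (intro into continuous_map_pairedI) (auto simp: P_def)
    show "continuous_map Z Y (\<lambda>b. e (y, b))"
      using assms by (intro into continuous_map_pairedI) (auto simp: P_def)
    show "continuous_map Y X (\<lambda>v. fst (inv e v))" "continuous_map Y Z (\<lambda>v. snd (inv e v))"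
      using inv_e by (simp_all add: continuous_map_pairwise o_def)
    show "topspace Y = (\<lambda>a. e (a, z)) ` topspace X \<union> (\<lambda>b. e (y, b)) ` topspace Z"
      unfolding top P_def by auto
  qed (simp_all add: assms ie)
  then show ?thesis
    by blast
qed

section \<open>Attaching an arc\<close>

lemma continuum_unit_interval: "continuum (top_of_set {0..1::real})"
  unfolding continuum_def
proof (intro conjI)
  show "compact_space (top_of_set {0..1::real})"
    by (simp add: compact_space_subtopology)
  show "connected_space (top_of_set {0..1::real})"
    by (metis connected_Icc connectedin_def connectedin_iff_connected)
  show "Hausdorff_space (top_of_set {0..1::real})"
    by (simp add: Hausdorff_space_subtopology)
  show "\<exists>x\<in>topspace (top_of_set {0..1::real}). \<exists>y\<in>topspace (top_of_set {0..1}). x \<noteq> y"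
    by (intro bexI[of _ 0] bexI[of _ 1]) simp_all
qed

text \<open>This bound lets an arc be attached over the same type. Compact Hausdorff spaces are
  normal, and a nondegenerate connected normal T1 space maps onto an interval by Urysohn's
  lemma.\<close>

lemma real_lepoll_continuum:
  fixes X :: "'a topology"
  assumes "continuum X"
  shows "(UNIV :: real set) \<lesssim> (UNIV :: 'a set)"
proof -
  have "connected_space X" "normal_space X"
    using assms compact_Hausdorff_or_regular_imp_normal_space[of X] by (simp_all add: continuum_def)
  then have "(UNIV :: real set) \<lesssim> topspace X"
    using continuum_t1_space[OF assms] continuum_not_singleton[OF assms]
    by (rule connected_space_imp_card_ge)
  also have "topspace X \<lesssim> (UNIV :: 'a set)"
    by (simp add: subset_imp_lepoll)
  finally show ?thesis .
qed

text \<open>If \<open>t < 1\<close>, density supplies a point \<open>c\<close> of \<open>S\<close>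
  beyond \<open>t\<close>, and a connected subset of \<open>S\<close> joining 0 to \<open>c\<close>
  would contain \<open>t\<close>.\<close>

lemma dense_semicontinuum_unit_interval:
  assumes S: "semicontinuum (top_of_set {0..1::real}) S" "S \<subseteq> {0..1} - {t}" "0 \<in> S"
    and dense: "top_of_set {0..1} closure_of S = {0..1}" and t: "t \<in> {0..1}"
  shows "t = 1"
proof (rule ccontr)
  assume "t \<noteq> 1"
  then have "t < 1"
    using t by auto
  have "openin (top_of_set {0..1}) ({0..1} \<inter> {t<..})"
    by (intro openin_open_Int) auto
  moreover have "1 \<in> {0..1} \<inter> {t<..}"
    using \<open>t < 1\<close> by simp
  then have "{0..1} \<inter> {t<..} \<noteq> {}"
    by (metis empty_iff)
  ultimately have "S \<inter> ({0..1} \<inter> {t<..}) \<noteq> {}"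
    using dense dense_intersects_open[of "top_of_set {0..1}" S] by simp
  then obtain c where "c \<in> S" "t < c"
    by blast
  then obtain K where K: "subcontinuum (top_of_set {0..1}) K" "K \<subseteq> S" "{0, c} \<subseteq> K"
    using S unfolding semicontinuum_def by meson
  then have "connected K"
    by (simp add: subcontinuum_def connectedin_subtopology)
  then have "t \<in> K"
    using K(3) \<open>t < c\<close> t connectedD_interval[of K 0 c t] by auto
  then show False
    using K(2) S(2) by blast
qed

locale arc_wedge = wedge X y "top_of_set {0..1::real}" 0 Y f r g s
  for X :: "'a topology" and y and Y :: "'c topology" and f r g s +
  assumes y_non_coastal: "non_coastal_point X y"
begin

definition tip where "tip = g 1"

lemma tip_in_topspace: "tip \<in> topspace Y"
  by (auto simp: tip_def cover)

lemma topspace_minus_tip: "topspace Y - {tip} = f ` topspace X \<union> g ` {0..<1}"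
proof
  show "topspace Y - {tip} \<subseteq> f ` topspace X \<union> g ` {0..<1}"
    by (auto simp: tip_def cover less_le)
  have "f a \<noteq> tip" if "a \<in> topspace X" for a
    using sf[OF that] sg[of 1] by (auto simp: tip_def)
  moreover have "g t \<noteq> tip" if "t \<in> {0..<1}" for t
    using sg[of t] sg[of 1] that by (auto simp: tip_def)
  ultimately show "f ` topspace X \<union> g ` {0..<1} \<subseteq> topspace Y - {tip}"
    by (auto simp: cover)
qed

text \<open>The whole of \<open>X\<close> and the arcs \<open>{0..t}\<close> with
  \<open>t < 1\<close> give subcontinua through the gluing point that avoid the tip.\<close>

lemma semicontinuum_minus_tip: "semicontinuum Y (topspace Y - {tip})"
proof (rule semicontinuum_star[where w = "f y"])
  fix c assume "c \<in> topspace Y - {tip}"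
  then consider "c \<in> f ` topspace X" | t where "t \<in> {0..<1}" "c = g t"
    unfolding topspace_minus_tip by blast
  then show "\<exists>K. subcontinuum Y K \<and> K \<subseteq> topspace Y - {tip} \<and> f y \<in> K \<and> c \<in> K"
  proof cases
    case 1
    then show ?thesis
      unfolding topspace_minus_tip
      using subcontinuum_image[OF f subcontinuum_topspace[OF X]] y by blast
  next
    case 2
    then have "subcontinuum (top_of_set {0..1}) {0..t}"
      by (auto simp: subcontinuum_def compactin_subtopology connectedin_subtopology)
    then have "subcontinuum Y (g ` {0..t})"
      by (rule subcontinuum_image[OF g])
    then show ?thesis
      unfolding topspace_minus_tip using 2 fy_gz
      by (intro exI[of _ "g ` {0..t}"]) auto
  qed
qed

text \<open>A continuum has no isolated point: an open singleton would be clopen and thus exhaust a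
  connected nondegenerate space.\<close>

lemma dense_minus_tip: "Y closure_of (topspace Y - {tip}) = topspace Y"
proof -
  have "topspace Y - {v} \<noteq> {} \<and> Y closure_of (topspace Y - {v}) = topspace Y" for v
    unfolding dense_intersects_open
  proof (intro conjI allI impI continuum_delete_point_nonempty[OF continuum_wedge])
    fix T assume T: "openin Y T \<and> T \<noteq> {}"
    show "(topspace Y - {v}) \<inter> T \<noteq> {}"
    proof
      assume e: "(topspace Y - {v}) \<inter> T = {}"
      then have "T = {v}"
        using T openin_subset by blast
      then have "openin Y {v}"
        using T by simp
      moreover have "closedin Y {v}"
        using T \<open>T = {v}\<close> continuum_t1_space[OF continuum_wedge] closedin_t1_singleton openin_subset
        by (metis insert_subset)
      ultimately have "{v} = topspace Y"
        using continuum_wedge unfolding continuum_def connected_space_clopen_in by blast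
      then show False
        using continuum_delete_point_nonempty[OF continuum_wedge, of v] by blast
    qed
  qed
  then show ?thesis
    by blast
qed

lemma non_block_point_tip: "non_block_point Y tip"
  unfolding non_block_point_iff[OF continuum_wedge]
  using tip_in_topspace semicontinuum_minus_tip dense_minus_tip by blast

text \<open>Points of \<open>X\<close> are excluded because \<open>y\<close> is non-coastal. A shore
  point \<open>g t\<close> gives, through the swapped wedge, a dense semicontinuum of the arc that
  contains 0 and misses \<open>t\<close>, so \<open>t = 1\<close>.\<close>

lemma shore_point_unique:
  assumes p: "shore_point Y p"
  shows "p = tip"
proof -
  interpret sw: wedge "top_of_set {0..1::real}" 0 X y Y g s f r
    by (rule swap)
  have "p \<in> topspace Y"
    using p by (simp add: shore_point_def)
  then obtain t where t: "t \<in> {0..1}" "p = g t"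
    using p non_coastal_imp_no_shore_point_left[OF y_non_coastal] unfolding cover by auto
  then obtain S where "semicontinuum (top_of_set {0..1}) S" "S \<subseteq> {0..1} - {t}"
    "top_of_set {0..1} closure_of S = {0..1}" "0 \<in> S"
    using sw.shore_point_imp_semicontinuum[of t] p by auto
  then have "t = 1"
    using t(1) by (metis dense_semicontinuum_unit_interval)
  then show ?thesis
    using t(2) by (simp add: tip_def)
qed

lemma shore_point_iff: "shore_point Y p \<longleftrightarrow> p = tip"
  using shore_point_unique non_block_point_imp_shore_point[OF continuum_wedge non_block_point_tip]
  by blast

lemma non_block_point_iff_tip: "non_block_point Y p \<longleftrightarrow> p = tip"
  using shore_point_unique non_block_point_imp_shore_point[OF continuum_wedge] non_block_point_tip
  by blast

text \<open>A coastal point differs from some non-block point, and the tip is the only one.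
  Conversely the complement of the tip is a dense semicontinuum that serves all other points at
  once.\<close>

lemma coastal_point_iff: "coastal_point Y x \<longleftrightarrow> x \<in> topspace Y \<and> x \<noteq> tip"
proof
  assume c: "coastal_point Y x"
  then obtain p where "non_block_point Y p" "p \<noteq> x"
    using coastal_point_avoids_non_block_point[OF continuum_wedge] by metis
  then show "x \<in> topspace Y \<and> x \<noteq> tip"
    using c coastal_point_in_topspace non_block_point_iff_tip by metis
next
  assume "x \<in> topspace Y \<and> x \<noteq> tip"
  then show "coastal_point Y x"
    using coastal_pointI[OF semicontinuum_minus_tip subset_refl tip_in_topspace dense_minus_tip]
    by blast
qed

lemma non_coastal_point_iff: "non_coastal_point Y x \<longleftrightarrow> x = tip"
  using tip_in_topspace by (auto simp: non_coastal_point_def coastal_point_iff)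

lemma partially_coastal_wedge: "partially_coastal Y"
  unfolding partially_coastal_def non_coastal_point_iff coastal_point_iff
  using continuum_delete_point_nonempty[OF continuum_wedge, of tip] by blast

end

section \<open>The two wedges and the equivalence\<close>

lemma wedge_without_shore_points:
  fixes X :: "'a topology"
  assumes "continuum X" "non_coastal_point X y"
  obtains Y :: "'a topology" where "continuum Y" "\<nexists>p. shore_point Y p"
proof -
  have "y \<in> topspace X"
    using assms(2) by (simp add: non_coastal_point_def)
  then obtain Y :: "'a topology" and f r g s where "wedge X y X y Y f r g s"
    using wedge_exists[of X y X y] assms(1) by (auto simp: lepoll_refl)
  then show thesis
    using that wedge.continuum_wedge wedge.non_coastal_imp_no_shore_point[OF _ assms(2,2)] by metis
qed

lemma wedge_with_arc:
  fixes X :: "'a topology"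
  assumes "continuum X" "non_coastal_point X y"
  obtains Y :: "'a topology" where "continuum Y" "\<exists>!p. shore_point Y p" "\<exists>!p. non_block_point Y p"
    "\<exists>!x. non_coastal_point Y x" "partially_coastal Y"
proof -
  have "y \<in> topspace X"
    using assms(2) by (simp add: non_coastal_point_def)
  then obtain Y :: "'a topology" and f r g s where "wedge X y (top_of_set {0..1::real}) 0 Y f r g s"
    using wedge_exists[of X y "top_of_set {0..1::real}" 0] assms(1) continuum_unit_interval
      real_lepoll_continuum by fastforce
  then interpret arc_wedge X y Y f r g s
    using assms(2) by (simp add: arc_wedge_def arc_wedge_axioms_def)
  show thesis
  proof (rule that[OF continuum_wedge])
    show "\<exists>!p. shore_point Y p" "\<exists>!p. non_block_point Y p" "\<exists>!x. non_coastal_point Y x"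
      by (simp_all add: shore_point_iff non_block_point_iff_tip non_coastal_point_iff)
  qed (rule partially_coastal_wedge)
qed

theorem theorem1:
  shows
   "((\<exists>X :: 'a topology. continuum X \<and> (\<nexists>x. coastal_point X x)) \<longleftrightarrow>
     (\<exists>X :: 'a topology. continuum X \<and> (\<exists>!x. non_coastal_point X x))) \<and>
    ((\<exists>X :: 'a topology. continuum X \<and> (\<exists>!x. non_coastal_point X x)) \<longleftrightarrow>
     (\<exists>X :: 'a topology. continuum X \<and> partially_coastal X)) \<and>
    ((\<exists>X :: 'a topology. continuum X \<and> partially_coastal X) \<longleftrightarrow>
     (\<exists>X :: 'a topology. continuum X \<and> (\<nexists>p. shore_point X p))) \<and>
    ((\<exists>X :: 'a topology. continuum X \<and> (\<nexists>p. shore_point X p)) \<longleftrightarrow>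
     (\<exists>X :: 'a topology. continuum X \<and> (\<exists>!p. shore_point X p))) \<and>
    ((\<exists>X :: 'a topology. continuum X \<and> (\<exists>!p. shore_point X p)) \<longleftrightarrow>
     (\<exists>X :: 'a topology. continuum X \<and> (\<nexists>p. non_block_point X p))) \<and>
    ((\<exists>X :: 'a topology. continuum X \<and> (\<nexists>p. non_block_point X p)) \<longleftrightarrow>
     (\<exists>X :: 'a topology. continuum X \<and> (\<exists>!p. non_block_point X p)))"
proof -
  let ?none = "\<lambda>P. \<exists>X :: 'a topology. continuum X \<and> (\<nexists>x. P X x)"
  let ?one = "\<lambda>P. \<exists>X :: 'a topology. continuum X \<and> (\<exists>!x. P X x)"
  let ?part = "\<exists>X :: 'a topology. continuum X \<and> partially_coastal X"
  \<comment> \<open>\<open>?N\<close> is the hub: each proposition leads to a non-coastal point, and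
    the wedges lead back from there.\<close>
  let ?N = "\<exists>(X :: 'a topology) y. continuum X \<and> non_coastal_point X y"
  have few: ?N if "continuum (X :: 'a topology)"
    "\<And>p q. non_block_point X p \<Longrightarrow> non_block_point X q \<Longrightarrow> p = q" for X
    using at_most_one_non_block_point_imp_non_coastal_point[OF that] that(1) by blast
  have block: "?none coastal_point \<longleftrightarrow> ?none non_block_point"
    using no_coastal_point_iff_no_non_block_point by blast
  \<comment> \<open>The absence of shore points reaches \<open>?N\<close> through the absence of
    non-block points; the absence of coastal points is tied to the latter by
    \<open>block\<close>.\<close>
  have shore: "?none shore_point \<Longrightarrow> ?none non_block_point"
    using non_block_point_imp_shore_point by metis
  have "?none non_block_point \<Longrightarrow> ?N" "?one non_block_point \<Longrightarrow> ?N" "?one shore_point \<Longrightarrow> ?N"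
    using few non_block_point_imp_shore_point by metis+
  moreover have "?one non_coastal_point \<Longrightarrow> ?N" "?part \<Longrightarrow> ?N"
    unfolding partially_coastal_def by blast+
  moreover have "?N \<Longrightarrow> ?none shore_point"
    using wedge_without_shore_points by metis
  moreover have "?N \<Longrightarrow> ?one shore_point" "?N \<Longrightarrow> ?one non_block_point"
    "?N \<Longrightarrow> ?one non_coastal_point" "?N \<Longrightarrow> ?part"
    using wedge_with_arc by metis+
  ultimately show ?thesis
    using block shore by argo
qed

end
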